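(* Let $f:\mathbb{R}^d\to\mathbb{R}$ be convex, with non-empty solution set $\mathcal{X}^\star=\{x^\star:f(x^\star)=\min_xf(x)\}$ and $\|\nabla f(x)-\nabla f(y)\|_2\le L\|x-y\|_2$ for all $x,y$. Suppose $f$ is coercive (for any sequence $\{u_k\}$, $\lim_k\|u_k-\mathrm{P}_\star(u_k)\|_2=+\infty$ implies $\lim_kf(u_k)=+\infty$) and $\nabla f$ is coercive with respect to $f$ (for any sequence $\{u_k\}$, $\lim_kf(u_k)=+\infty$ implies $\lim_k\|\nabla f(u_k)\|_2=+\infty$). Let $x_{k+1}=x_k-\alpha\hat g_k$ with $\alpha=1/L$, and suppose $\|\nabla f(x_k)-\hat g_k\|_2^2\le\varepsilon_{\mathrm{abs}}+\varepsilon_{\mathrm{rel}}\|\nabla f(x_k)\|_2^2$ for all $k$, with $\varepsilon_{\mathrm{rel}}<1$. Then there exists $R>0$ such that $\|x_k-\mathrm{P}_\star(x_k)\|_2\le R$ for all $k$.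
   Context: $\mathrm{P}_\star(x)=\mathrm{argmin}_{y\in\mathcal{X}^\star}\|y-x\|_2$. $\varepsilon_{\mathrm{rel}},\varepsilon_{\mathrm{abs}}\ge0$ are fixed constants independent of $k$. *)

theory Defs
  imports "HOL-Analysis.Analysis"
begin

definition solution_set :: "('a \<Rightarrow> real) \<Rightarrow> 'a set" where
  "solution_set f = {x. \<forall>y. f x \<le> f y}"

text \<open>The library's \<^const>\<open>closest_point\<close> is the argmin of the distance over the
  given set. The argmin exists and is unique here, because the solution set of a
  differentiable convex function is closed and convex.\<close>

definition proj_star :: "(real ^ 'd \<Rightarrow> real) \<Rightarrow> real ^ 'd \<Rightarrow> real ^ 'd" where
  "proj_star f x = closest_point (solution_set f) x"

definition coercive :: "(real ^ 'd \<Rightarrow> real) \<Rightarrow> bool" where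
  "coercive f \<longleftrightarrow>
     (\<forall>u :: nat \<Rightarrow> real ^ 'd.
        filterlim (\<lambda>k. norm (u k - proj_star f (u k))) at_top sequentially \<longrightarrow>
        filterlim (\<lambda>k. f (u k)) at_top sequentially)"

definition gradient_coercive ::
  "(real ^ 'd \<Rightarrow> real) \<Rightarrow> (real ^ 'd \<Rightarrow> real ^ 'd) \<Rightarrow> bool" where
  "gradient_coercive f gradf \<longleftrightarrow>
     (\<forall>u :: nat \<Rightarrow> real ^ 'd.
        filterlim (\<lambda>k. f (u k)) at_top sequentially \<longrightarrow>
        filterlim (\<lambda>k. norm (gradf (u k))) at_top sequentially)"

end

theory Submission
  imports Defs
begin

text \<open>
  With step size \<open>1 / L\<close> the descent inequality for an \<open>L\<close>-smooth function becomes, after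
  completing the square,
  \<open>f (x (k+1)) \<le> f (x k) + (\<parallel>\<nabla>f (x k) - g k\<parallel>\<^sup>2 - \<parallel>\<nabla>f (x k)\<parallel>\<^sup>2) / (2L)\<close>
  (lemma \<open>inexact_gradient_step_descent\<close>). The error model then bounds the increase of \<open>f\<close> in
  one step by \<open>(eps_abs - (1 - eps_rel) \<parallel>\<nabla>f (x k)\<parallel>\<^sup>2) / (2L)\<close>.
  So the value never rises by more than \<open>eps_abs / (2L)\<close>, and it does not rise at all where the
  gradient is large. Since the gradient is coercive with respect to \<open>f\<close>, it is large
  wherever \<open>f\<close> exceeds some level \<open>M\<close>. Hence the values can overshoot \<open>M\<close> by at most one
  increment, and they stay bounded (lemma \<open>bounded_above_if_decreasing_above_level\<close>). Coercivity of
  \<open>f\<close> turns a bound on the values into a bound on the distance to the solution set.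

  Both coercivity hypotheses speak of sequences; lemma \<open>sequential_coercivity_uniform\<close> extracts
  from them the uniform thresholds that this argument uses.
\<close>

text \<open>If there were no threshold \<open>R\<close>, the points violating \<open>R = n\<close> for \<open>n = 0, 1, \<dots>\<close> would form a
  sequence along which \<open>a\<close> diverges and \<open>b\<close> stays bounded.\<close>

lemma sequential_coercivity_uniform:
  fixes a b :: "'a \<Rightarrow> real"
  assumes "\<And>u :: nat \<Rightarrow> 'a. filterlim (\<lambda>k. a (u k)) at_top sequentially
             \<Longrightarrow> filterlim (\<lambda>k. b (u k)) at_top sequentially"
  shows "\<exists>R. \<forall>v. a v > R \<longrightarrow> b v > B"
proof (rule ccontr)
  assume "\<not> ?thesis"
  then have "\<forall>n :: nat. \<exists>v. a v > real n \<and> b v \<le> B"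
    by (meson not_le)
  then obtain u where u: "\<And>n. a (u n) > real n" "\<And>n. b (u n) \<le> B"
    by metis
  have "filterlim (\<lambda>n. a (u n)) at_top sequentially"
    by (rule filterlim_at_top_mono[OF filterlim_real_sequentially])
       (simp add: u(1) less_imp_le)
  then have "filterlim (\<lambda>n. b (u n)) at_top sequentially"
    by (rule assms)
  then have "eventually (\<lambda>n. b (u n) > B) sequentially"
    by (simp add: filterlim_at_top_dense)
  moreover have "\<not> b (u n) > B" for n
    using u(2)[of n] by simp
  ultimately show False
    by simp
qed

text \<open>The descent lemma for \<open>L\<close>-smooth functions. Along the segment from \<open>y\<close> to \<open>y + h\<close> the
  Lipschitz bound and the Cauchy-Schwarz inequality make the difference of the two sides
  monotone.\<close>

lemma lipschitz_gradient_upper_bound: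
  fixes f :: "'a::real_inner \<Rightarrow> real"
  assumes gradient: "\<And>y. GDERIV f y :> gradf y"
    and lipschitz: "\<And>y z. norm (gradf y - gradf z) \<le> L * norm (y - z)"
  shows "f (y + h) \<le> f y + gradf y \<bullet> h + L / 2 * (norm h)\<^sup>2"
proof -
  define p where "p t = f (y + t *\<^sub>R h) - t * (gradf y \<bullet> h) - L / 2 * t\<^sup>2 * (norm h)\<^sup>2" for t
  have f_line: "((\<lambda>t. f (y + t *\<^sub>R h)) has_real_derivative gradf (y + t *\<^sub>R h) \<bullet> h) (at t)" for t
  proof -
    have "(f has_derivative (\<lambda>v. v \<bullet> gradf (y + t *\<^sub>R h))) (at (y + t *\<^sub>R h))"
      using gradient by (simp add: gderiv_def)
    moreover have "((\<lambda>t. y + t *\<^sub>R h) has_derivative (\<lambda>s. s *\<^sub>R h)) (at t)"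
      by (auto intro!: derivative_eq_intros)
    ultimately have "((\<lambda>t. f (y + t *\<^sub>R h)) has_derivative
        (\<lambda>s. (s *\<^sub>R h) \<bullet> gradf (y + t *\<^sub>R h))) (at t)"
      by (rule has_derivative_compose[rotated])
    then show ?thesis
      unfolding has_field_derivative_def
      by (rule has_derivative_eq_rhs) (simp add: fun_eq_iff inner_commute)
  qed
  have p_deriv: "(p has_real_derivative
      (gradf (y + t *\<^sub>R h) \<bullet> h - gradf y \<bullet> h - L * t * (norm h)\<^sup>2)) (at t)" for t
    unfolding p_def by (rule derivative_eq_intros f_line refl | simp)+
  have p_deriv_nonpos: "gradf (y + t *\<^sub>R h) \<bullet> h - gradf y \<bullet> h - L * t * (norm h)\<^sup>2 \<le> 0"
    if "t \<ge> 0" for t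
  proof -
    have "gradf (y + t *\<^sub>R h) \<bullet> h - gradf y \<bullet> h = (gradf (y + t *\<^sub>R h) - gradf y) \<bullet> h"
      by (simp add: inner_diff_left)
    also have "\<dots> \<le> norm (gradf (y + t *\<^sub>R h) - gradf y) * norm h"
      by (rule norm_cauchy_schwarz)
    also have "\<dots> \<le> (L * norm (t *\<^sub>R h)) * norm h"
      using lipschitz[of "y + t *\<^sub>R h" y] by (intro mult_right_mono) auto
    also have "\<dots> = L * t * (norm h)\<^sup>2"
      using that by (simp add: power2_eq_square)
    finally show ?thesis
      by simp
  qed
  have "p 1 \<le> p 0"
    by (rule DERIV_nonpos_imp_nonincreasing[of 0 1 p]) (use p_deriv p_deriv_nonpos in fastforce)+
  then show ?thesis
    by (simp add: p_def)
qed

text \<open>The step size \<open>1 / L\<close> minimises the quadratic upper bound when the direction is exact, so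
  the error of the direction enters only through its square.\<close>

lemma inexact_gradient_step_descent:
  fixes f :: "'a::real_inner \<Rightarrow> real"
  assumes "\<And>y. GDERIV f y :> gradf y"
    and "L > 0"
    and "\<And>y z. norm (gradf y - gradf z) \<le> L * norm (y - z)"
  shows "f (y - (1 / L) *\<^sub>R d) \<le> f y + ((norm (gradf y - d))\<^sup>2 - (norm (gradf y))\<^sup>2) / (2 * L)"
proof -
  have "f (y + - ((1 / L) *\<^sub>R d))
      \<le> f y + gradf y \<bullet> (- ((1 / L) *\<^sub>R d)) + L / 2 * (norm (- ((1 / L) *\<^sub>R d)))\<^sup>2"
    by (rule lipschitz_gradient_upper_bound[OF assms(1,3)])
  also have "\<dots> = f y + ((norm (gradf y - d))\<^sup>2 - (norm (gradf y))\<^sup>2) / (2 * L)"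
  proof -
    have "(norm (gradf y - d))\<^sup>2 - (norm (gradf y))\<^sup>2 = (norm d)\<^sup>2 - 2 * (gradf y \<bullet> d)"
      by (simp add: power2_norm_eq_inner inner_diff_left inner_diff_right inner_commute)
    then show ?thesis
      using \<open>L > 0\<close> by (simp add: field_simps power2_eq_square)
  qed
  finally show ?thesis
    by simp
qed

text \<open>A jump above the level \<open>M\<close> starts at a value of at most \<open>M\<close>, so it ends at most at
  \<open>M + c\<close>; from there the sequence cannot increase until it is back below \<open>M\<close>.\<close>

lemma bounded_above_if_decreasing_above_level:
  fixes s :: "nat \<Rightarrow> real"
  assumes "\<And>k. s (Suc k) \<le> s k + c"
    and "\<And>k. s k > M \<Longrightarrow> s (Suc k) \<le> s k"
  shows "s k \<le> max (s 0) (M + c)"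
proof (induction k)
  case (Suc k)
  show ?case
    using assms(1)[of k] assms(2)[of k] Suc by (cases "s k > M") auto
qed simp

theorem proposition5p1:
  fixes f :: "real ^ 'd \<Rightarrow> real"
    and gradf :: "real ^ 'd \<Rightarrow> real ^ 'd"
    and x g :: "nat \<Rightarrow> real ^ 'd"
    and L \<alpha> eps_abs eps_rel :: real
  assumes convex: "convex_on UNIV f"
    and solutions: "solution_set f \<noteq> {}"
    and gradient: "\<And>y. GDERIV f y :> gradf y"
    and L_pos: "L > 0"
    and lipschitz: "\<And>y z. norm (gradf y - gradf z) \<le> L * norm (y - z)"
    and coercive: "coercive f"
    and gradient_coercive: "gradient_coercive f gradf"
    and step_size: "\<alpha> = 1 / L"
    and iteration: "\<And>k. x (Suc k) = x k - \<alpha> *\<^sub>R g k"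
    and eps_abs: "eps_abs \<ge> 0"
    and eps_rel: "eps_rel \<ge> 0" "eps_rel < 1"
    and error: "\<And>k. (norm (gradf (x k) - g k))\<^sup>2
                  \<le> eps_abs + eps_rel * (norm (gradf (x k)))\<^sup>2"
  shows "\<exists>R>0. \<forall>k. norm (x k - proj_star f (x k)) \<le> R"
proof -
  have step: "f (x (Suc k)) \<le> f (x k) + (eps_abs - (1 - eps_rel) * (norm (gradf (x k)))\<^sup>2) / (2 * L)"
    for k
  proof -
    have "f (x (Suc k))
        \<le> f (x k) + ((norm (gradf (x k) - g k))\<^sup>2 - (norm (gradf (x k)))\<^sup>2) / (2 * L)"
      using inexact_gradient_step_descent[OF gradient L_pos lipschitz]
      by (simp add: iteration step_size)
    also have "\<dots> \<le> f (x k) + (eps_abs - (1 - eps_rel) * (norm (gradf (x k)))\<^sup>2) / (2 * L)"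
      using error[of k] L_pos by (intro add_left_mono divide_right_mono) (auto simp: algebra_simps)
    finally show ?thesis .
  qed
  have small_increase: "f (x (Suc k)) \<le> f (x k) + eps_abs / (2 * L)" for k
  proof -
    have "(eps_abs - (1 - eps_rel) * (norm (gradf (x k)))\<^sup>2) / (2 * L) \<le> eps_abs / (2 * L)"
      using eps_rel L_pos by (intro divide_right_mono) auto
    then show ?thesis
      using step[of k] by linarith
  qed
  \<comment> \<open>Gradients longer than this radius make the increment in \<open>step\<close> nonpositive.\<close>
  define G where "G = sqrt (eps_abs / (1 - eps_rel))"
  obtain M where M: "\<And>y. f y > M \<Longrightarrow> norm (gradf y) > G"
    using sequential_coercivity_uniform[of f "\<lambda>y. norm (gradf y)" G] gradient_coercive
    unfolding gradient_coercive_def by blast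
  have decrease: "f (x (Suc k)) \<le> f (x k)" if "f (x k) > M" for k
  proof -
    have "eps_abs / (1 - eps_rel) \<le> (norm (gradf (x k)))\<^sup>2"
      using M[OF that] by (intro sqrt_le_D) (simp add: G_def)
    then have "eps_abs - (1 - eps_rel) * (norm (gradf (x k)))\<^sup>2 \<le> 0"
      using eps_rel by (simp add: field_simps)
    then have "(eps_abs - (1 - eps_rel) * (norm (gradf (x k)))\<^sup>2) / (2 * L) \<le> 0"
      using L_pos by (intro divide_nonpos_pos) auto
    then show ?thesis
      using step[of k] by linarith
  qed
  define B where "B = max (f (x 0)) (M + eps_abs / (2 * L))"
  have value_bound: "f (x k) \<le> B" for k
    unfolding B_def
    by (rule bounded_above_if_decreasing_above_level[where s = "\<lambda>k. f (x k)"])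
       (use small_increase decrease in auto)
  obtain R where R: "\<And>y. norm (y - proj_star f y) > R \<Longrightarrow> f y > B"
    using sequential_coercivity_uniform[of "\<lambda>y. norm (y - proj_star f y)" f B] coercive
    unfolding coercive_def by blast
  have "norm (x k - proj_star f (x k)) \<le> max R 1" for k
    using R[of "x k"] value_bound[of k] by force
  then show ?thesis
    by (intro exI[of _ "max R 1"]) auto
qed

end
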